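(* Let $\mathcal{H}$ be a pre-Hilbert category and $f:X\to Y$ a morphism. Define $f^\perp=\perp_Y\circ\exists_f^{\mathrm{op}}:\mathrm{ClSub}(X)^{\mathrm{op}}\to\mathrm{ClSub}(Y)$ and similarly $(f^\dagger)^\perp=\perp_X\circ\exists_{f^\dagger}^{\mathrm{op}}:\mathrm{ClSub}(Y)^{\mathrm{op}}\to\mathrm{ClSub}(X)$. Then $(f^\perp)^{\mathrm{op}}\dashv(f^\dagger)^\perp$; explicitly, for all $M\in\mathrm{ClSub}(X)$ and $N\in\mathrm{ClSub}(Y)$, $N\le(\exists_f M)^\perp$ if and only if $M\le(\exists_{f^\dagger}N)^\perp$.
   Context: A $\dagger$-category is a category $\mathcal{H}$ with a functor $\dagger:\mathcal{H}^{\mathrm{op}}\to\mathcal{H}$ that is the identity on objects with $f^{\dagger\dagger}=f$. A morphism $m$ is a $\dagger$-mono if $m^\dagger m=\mathrm{id}$, a $\dagger$-epi if $mm^\dagger=\mathrm{id}$. A pre-Hilbert category is a $\dagger$-category such that: it has finite $\dagger$-biproducts (finite biproducts, including a zero object, with $\pi^\dagger=\kappa$); it has finite $\dagger$-equalisers (equalisers that are $\dagger$-monos); every $\dagger$-mono is a kernel of some morphism; and it is symmetric $\dagger$-monoidal ($(f\otimes g)^\dagger=f^\dagger\otimes g^\dagger$, coherence isomorphisms $\dagger$-isos). Kernels are chosen to be $\dagger$-monos. A subobject of $X$ is an equivalence class of monos into $X$ (modulo isomorphism of domains commuting with the monos), ordered by factorisation; $\mathrm{ClSub}(X)$ is the poset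 (viewed as a category) of subobjects representable by a $\dagger$-mono. Every morphism $h$ factors as $h=me$ with $e$ epi and $m$ a $\dagger$-mono, unique up to $\dagger$-iso; $\mathrm{Im}(h)$ is the subobject represented by $m$. For $f:X\to Y$, $\exists_f:\mathrm{ClSub}(X)\to\mathrm{ClSub}(Y)$ is $\exists_f(M)=\mathrm{Im}(f\circ m)$ for $m$ a $\dagger$-mono representing $M$. $\perp_X:\mathrm{ClSub}(X)^{\mathrm{op}}\to\mathrm{ClSub}(X)$ sends $m$ to $m^\perp=\ker(m^\dagger)$. *)

theory Defs
  imports "HOL-Algebra.Galois_Connection"
begin

section \<open>Categories\<close>

record ('o, 'm) category =
  Obj :: "'o set"
  Arr :: "'m set"
  Dom :: "'m \<Rightarrow> 'o"
  Cod :: "'m \<Rightarrow> 'o"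
  Id :: "'o \<Rightarrow> 'm"
  Comp :: "'m \<Rightarrow> 'm \<Rightarrow> 'm" (infixr \<open>\<cdot>\<index>\<close> 75)

definition Hom :: "('o, 'm, 'z) category_scheme \<Rightarrow> 'o \<Rightarrow> 'o \<Rightarrow> 'm set" where
  "Hom C A B = {f \<in> Arr C. Dom C f = A \<and> Cod C f = B}"

locale category =
  fixes C (structure)
  assumes Dom_closed: "f \<in> Arr C \<Longrightarrow> Dom C f \<in> Obj C"
    and Cod_closed: "f \<in> Arr C \<Longrightarrow> Cod C f \<in> Obj C"
    and Id_closed: "A \<in> Obj C \<Longrightarrow> Id C A \<in> Hom C A A"
    and Comp_closed: "f \<in> Hom C A B \<Longrightarrow> g \<in> Hom C B D \<Longrightarrow> g \<cdot> f \<in> Hom C A D"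
    and Id_left: "f \<in> Hom C A B \<Longrightarrow> Id C B \<cdot> f = f"
    and Id_right: "f \<in> Hom C A B \<Longrightarrow> f \<cdot> Id C A = f"
    and Comp_assoc: "f \<in> Hom C A B \<Longrightarrow> g \<in> Hom C B D \<Longrightarrow> h \<in> Hom C D E \<Longrightarrow>
      (h \<cdot> g) \<cdot> f = h \<cdot> (g \<cdot> f)"

definition is_monic :: "('o, 'm, 'z) category_scheme \<Rightarrow> 'm \<Rightarrow> bool" where
  "is_monic C m \<longleftrightarrow> m \<in> Arr C \<and>
    (\<forall>A. \<forall>g \<in> Hom C A (Dom C m). \<forall>h \<in> Hom C A (Dom C m).
      m \<cdot>\<^bsub>C\<^esub> g = m \<cdot>\<^bsub>C\<^esub> h \<longrightarrow> g = h)"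

definition is_epic :: "('o, 'm, 'z) category_scheme \<Rightarrow> 'm \<Rightarrow> bool" where
  "is_epic C e \<longleftrightarrow> e \<in> Arr C \<and>
    (\<forall>B. \<forall>g \<in> Hom C (Cod C e) B. \<forall>h \<in> Hom C (Cod C e) B.
      g \<cdot>\<^bsub>C\<^esub> e = h \<cdot>\<^bsub>C\<^esub> e \<longrightarrow> g = h)"

definition is_iso :: "('o, 'm, 'z) category_scheme \<Rightarrow> 'm \<Rightarrow> bool" where
  "is_iso C f \<longleftrightarrow> f \<in> Arr C \<and>
    (\<exists>g \<in> Hom C (Cod C f) (Dom C f).
      g \<cdot>\<^bsub>C\<^esub> f = Id C (Dom C f) \<and> f \<cdot>\<^bsub>C\<^esub> g = Id C (Cod C f))"

definition is_zero_object :: "('o, 'm, 'z) category_scheme \<Rightarrow> 'o \<Rightarrow> bool" where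
  "is_zero_object C Z \<longleftrightarrow> Z \<in> Obj C \<and>
    (\<forall>A \<in> Obj C. \<exists>!f. f \<in> Hom C A Z) \<and> (\<forall>A \<in> Obj C. \<exists>!f. f \<in> Hom C Z A)"

definition is_zero_arr :: "('o, 'm, 'z) category_scheme \<Rightarrow> 'm \<Rightarrow> bool" where
  "is_zero_arr C f \<longleftrightarrow> f \<in> Arr C \<and>
    (\<exists>Z. is_zero_object C Z \<and>
      (\<exists>a \<in> Hom C (Dom C f) Z. \<exists>b \<in> Hom C Z (Cod C f). f = b \<cdot>\<^bsub>C\<^esub> a))"

definition is_kernel :: "('o, 'm, 'z) category_scheme \<Rightarrow> 'm \<Rightarrow> 'm \<Rightarrow> bool" where
  "is_kernel C k f \<longleftrightarrow> k \<in> Arr C \<and> f \<in> Arr C \<and> Cod C k = Dom C f \<and> is_zero_arr C (f \<cdot>\<^bsub>C\<^esub> k) \<and>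
    (\<forall>A. \<forall>g \<in> Hom C A (Dom C f). is_zero_arr C (f \<cdot>\<^bsub>C\<^esub> g) \<longrightarrow>
      (\<exists>!h. h \<in> Hom C A (Dom C k) \<and> k \<cdot>\<^bsub>C\<^esub> h = g))"

definition is_equaliser :: "('o, 'm, 'z) category_scheme \<Rightarrow> 'm \<Rightarrow> 'm \<Rightarrow> 'm \<Rightarrow> bool" where
  "is_equaliser C e f f' \<longleftrightarrow> e \<in> Arr C \<and> f \<in> Hom C (Cod C e) (Cod C f) \<and>
    f' \<in> Hom C (Cod C e) (Cod C f) \<and> f \<cdot>\<^bsub>C\<^esub> e = f' \<cdot>\<^bsub>C\<^esub> e \<and>
    (\<forall>A. \<forall>g \<in> Hom C A (Cod C e). f \<cdot>\<^bsub>C\<^esub> g = f' \<cdot>\<^bsub>C\<^esub> g \<longrightarrow>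
      (\<exists>!h. h \<in> Hom C A (Dom C e) \<and> e \<cdot>\<^bsub>C\<^esub> h = g))"

definition is_product :: "('o, 'm, 'z) category_scheme \<Rightarrow> 'o \<Rightarrow> 'o \<Rightarrow> 'o \<Rightarrow> 'm \<Rightarrow> 'm \<Rightarrow> bool" where
  "is_product C A B P p q \<longleftrightarrow> p \<in> Hom C P A \<and> q \<in> Hom C P B \<and>
    (\<forall>T. \<forall>f \<in> Hom C T A. \<forall>g \<in> Hom C T B.
      \<exists>!h. h \<in> Hom C T P \<and> p \<cdot>\<^bsub>C\<^esub> h = f \<and> q \<cdot>\<^bsub>C\<^esub> h = g)"

definition is_coproduct :: "('o, 'm, 'z) category_scheme \<Rightarrow> 'o \<Rightarrow> 'o \<Rightarrow> 'o \<Rightarrow> 'm \<Rightarrow> 'm \<Rightarrow> bool" where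
  "is_coproduct C A B P i j \<longleftrightarrow> i \<in> Hom C A P \<and> j \<in> Hom C B P \<and>
    (\<forall>T. \<forall>f \<in> Hom C A T. \<forall>g \<in> Hom C B T.
      \<exists>!h. h \<in> Hom C P T \<and> h \<cdot>\<^bsub>C\<^esub> i = f \<and> h \<cdot>\<^bsub>C\<^esub> j = g)"

definition is_biproduct ::
  "('o, 'm, 'z) category_scheme \<Rightarrow> 'o \<Rightarrow> 'o \<Rightarrow> 'o \<Rightarrow> 'm \<Rightarrow> 'm \<Rightarrow> 'm \<Rightarrow> 'm \<Rightarrow> bool" where
  "is_biproduct C A B P p q i j \<longleftrightarrow> is_product C A B P p q \<and> is_coproduct C A B P i j \<and>
    p \<cdot>\<^bsub>C\<^esub> i = Id C A \<and> q \<cdot>\<^bsub>C\<^esub> j = Id C B \<and>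
    is_zero_arr C (p \<cdot>\<^bsub>C\<^esub> j) \<and> is_zero_arr C (q \<cdot>\<^bsub>C\<^esub> i)"


section \<open>Dagger categories\<close>

record ('o, 'm) dagger_category = "('o, 'm) category" +
  Dag :: "'m \<Rightarrow> 'm"

locale dagger_category = category C for C (structure) +
  assumes Dag_closed: "f \<in> Hom C A B \<Longrightarrow> Dag C f \<in> Hom C B A"
    and Dag_Id: "A \<in> Obj C \<Longrightarrow> Dag C (Id C A) = Id C A"
    and Dag_Comp: "f \<in> Hom C A B \<Longrightarrow> g \<in> Hom C B D \<Longrightarrow> Dag C (g \<cdot> f) = Dag C f \<cdot> Dag C g"
    and Dag_Dag: "f \<in> Arr C \<Longrightarrow> Dag C (Dag C f) = f"

definition dagger_mono :: "('o, 'm, 'z) dagger_category_scheme \<Rightarrow> 'm \<Rightarrow> bool" where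
  "dagger_mono C m \<longleftrightarrow> m \<in> Arr C \<and> Dag C m \<cdot>\<^bsub>C\<^esub> m = Id C (Dom C m)"

definition dagger_epi :: "('o, 'm, 'z) dagger_category_scheme \<Rightarrow> 'm \<Rightarrow> bool" where
  "dagger_epi C e \<longleftrightarrow> e \<in> Arr C \<and> e \<cdot>\<^bsub>C\<^esub> Dag C e = Id C (Cod C e)"

definition dagger_iso :: "('o, 'm, 'z) dagger_category_scheme \<Rightarrow> 'm \<Rightarrow> bool" where
  "dagger_iso C f \<longleftrightarrow> dagger_mono C f \<and> dagger_epi C f"

record ('o, 'm) dagger_monoidal_category = "('o, 'm) dagger_category" +
  Tensor_obj :: "'o \<Rightarrow> 'o \<Rightarrow> 'o" (infixr \<open>\<otimes>\<^sub>o\<index>\<close> 80)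
  Tensor_arr :: "'m \<Rightarrow> 'm \<Rightarrow> 'm" (infixr \<open>\<otimes>\<^sub>m\<index>\<close> 80)
  Unit :: "'o"
  Assoc :: "'o \<Rightarrow> 'o \<Rightarrow> 'o \<Rightarrow> 'm"
  Lunit :: "'o \<Rightarrow> 'm"
  Runit :: "'o \<Rightarrow> 'm"
  Swap :: "'o \<Rightarrow> 'o \<Rightarrow> 'm"

locale symmetric_dagger_monoidal_category = dagger_category C for C (structure) +
  assumes Tensor_obj_closed: "A \<in> Obj C \<Longrightarrow> B \<in> Obj C \<Longrightarrow> A \<otimes>\<^sub>o B \<in> Obj C"
    and Unit_closed: "Unit C \<in> Obj C"
    and Tensor_arr_closed: "f \<in> Hom C A A' \<Longrightarrow> g \<in> Hom C B B' \<Longrightarrow>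
      f \<otimes>\<^sub>m g \<in> Hom C (A \<otimes>\<^sub>o B) (A' \<otimes>\<^sub>o B')"
    and Tensor_Id: "A \<in> Obj C \<Longrightarrow> B \<in> Obj C \<Longrightarrow> Id C A \<otimes>\<^sub>m Id C B = Id C (A \<otimes>\<^sub>o B)"
    and Tensor_Comp: "f \<in> Hom C A A' \<Longrightarrow> f' \<in> Hom C A' A'' \<Longrightarrow>
      g \<in> Hom C B B' \<Longrightarrow> g' \<in> Hom C B' B'' \<Longrightarrow>
      (f' \<cdot> f) \<otimes>\<^sub>m (g' \<cdot> g) = (f' \<otimes>\<^sub>m g') \<cdot> (f \<otimes>\<^sub>m g)"
    and Tensor_Dag: "f \<in> Arr C \<Longrightarrow> g \<in> Arr C \<Longrightarrow> Dag C (f \<otimes>\<^sub>m g) = Dag C f \<otimes>\<^sub>m Dag C g"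
    and Assoc_closed: "A \<in> Obj C \<Longrightarrow> B \<in> Obj C \<Longrightarrow> D \<in> Obj C \<Longrightarrow>
      Assoc C A B D \<in> Hom C ((A \<otimes>\<^sub>o B) \<otimes>\<^sub>o D) (A \<otimes>\<^sub>o (B \<otimes>\<^sub>o D))"
    and Lunit_closed: "A \<in> Obj C \<Longrightarrow> Lunit C A \<in> Hom C (Unit C \<otimes>\<^sub>o A) A"
    and Runit_closed: "A \<in> Obj C \<Longrightarrow> Runit C A \<in> Hom C (A \<otimes>\<^sub>o Unit C) A"
    and Swap_closed: "A \<in> Obj C \<Longrightarrow> B \<in> Obj C \<Longrightarrow> Swap C A B \<in> Hom C (A \<otimes>\<^sub>o B) (B \<otimes>\<^sub>o A)"
    and Assoc_dagger_iso: "A \<in> Obj C \<Longrightarrow> B \<in> Obj C \<Longrightarrow> D \<in> Obj C \<Longrightarrow> dagger_iso C (Assoc C A B D)"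
    and Lunit_dagger_iso: "A \<in> Obj C \<Longrightarrow> dagger_iso C (Lunit C A)"
    and Runit_dagger_iso: "A \<in> Obj C \<Longrightarrow> dagger_iso C (Runit C A)"
    and Swap_dagger_iso: "A \<in> Obj C \<Longrightarrow> B \<in> Obj C \<Longrightarrow> dagger_iso C (Swap C A B)"
    and Assoc_natural: "f \<in> Hom C A A' \<Longrightarrow> g \<in> Hom C B B' \<Longrightarrow> h \<in> Hom C D D' \<Longrightarrow>
      Assoc C A' B' D' \<cdot> ((f \<otimes>\<^sub>m g) \<otimes>\<^sub>m h) = (f \<otimes>\<^sub>m (g \<otimes>\<^sub>m h)) \<cdot> Assoc C A B D"
    and Lunit_natural: "f \<in> Hom C A A' \<Longrightarrow> Lunit C A' \<cdot> (Id C (Unit C) \<otimes>\<^sub>m f) = f \<cdot> Lunit C A"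
    and Runit_natural: "f \<in> Hom C A A' \<Longrightarrow> Runit C A' \<cdot> (f \<otimes>\<^sub>m Id C (Unit C)) = f \<cdot> Runit C A"
    and Swap_natural: "f \<in> Hom C A A' \<Longrightarrow> g \<in> Hom C B B' \<Longrightarrow>
      Swap C A' B' \<cdot> (f \<otimes>\<^sub>m g) = (g \<otimes>\<^sub>m f) \<cdot> Swap C A B"
    and pentagon: "A \<in> Obj C \<Longrightarrow> B \<in> Obj C \<Longrightarrow> D \<in> Obj C \<Longrightarrow> E \<in> Obj C \<Longrightarrow>
      Assoc C A B (D \<otimes>\<^sub>o E) \<cdot> Assoc C (A \<otimes>\<^sub>o B) D E =
      (Id C A \<otimes>\<^sub>m Assoc C B D E) \<cdot> Assoc C A (B \<otimes>\<^sub>o D) E \<cdot> (Assoc C A B D \<otimes>\<^sub>m Id C E)"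
    and triangle: "A \<in> Obj C \<Longrightarrow> B \<in> Obj C \<Longrightarrow>
      (Id C A \<otimes>\<^sub>m Lunit C B) \<cdot> Assoc C A (Unit C) B = Runit C A \<otimes>\<^sub>m Id C B"
    and hexagon: "A \<in> Obj C \<Longrightarrow> B \<in> Obj C \<Longrightarrow> D \<in> Obj C \<Longrightarrow>
      Assoc C B D A \<cdot> Swap C A (B \<otimes>\<^sub>o D) \<cdot> Assoc C A B D =
      (Id C B \<otimes>\<^sub>m Swap C A D) \<cdot> Assoc C B A D \<cdot> (Swap C A B \<otimes>\<^sub>m Id C D)"
    and symmetry: "A \<in> Obj C \<Longrightarrow> B \<in> Obj C \<Longrightarrow> Swap C B A \<cdot> Swap C A B = Id C (A \<otimes>\<^sub>o B)"


section \<open>Pre-Hilbert categories\<close>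

text \<open>Finite biproducts are given by a zero object and binary biproducts, finite equalisers by
  equalisers of parallel pairs.\<close>

locale pre_hilbert_category = symmetric_dagger_monoidal_category C for C (structure) +
  assumes zero_object: "\<exists>Z. is_zero_object C Z"
    and dagger_biproducts: "A \<in> Obj C \<Longrightarrow> B \<in> Obj C \<Longrightarrow>
      \<exists>P p q i j. is_biproduct C A B P p q i j \<and> Dag C p = i \<and> Dag C q = j"
    and dagger_equalisers: "f \<in> Hom C A B \<Longrightarrow> g \<in> Hom C A B \<Longrightarrow>
      \<exists>e. is_equaliser C e f g \<and> dagger_mono C e"
    and dagger_mono_kernel: "dagger_mono C m \<Longrightarrow> \<exists>f. is_kernel C m f"


section \<open>Subobjects\<close>

definition subobject_rel :: "('o, 'm, 'z) category_scheme \<Rightarrow> 'o \<Rightarrow> ('m \<times> 'm) set" where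
  "subobject_rel C X = {(m, n). is_monic C m \<and> is_monic C n \<and> Cod C m = X \<and> Cod C n = X \<and>
    (\<exists>u \<in> Hom C (Dom C m) (Dom C n). is_iso C u \<and> m = n \<cdot>\<^bsub>C\<^esub> u)}"

definition Sub :: "('o, 'm, 'z) category_scheme \<Rightarrow> 'o \<Rightarrow> 'm set set" where
  "Sub C X = {m. is_monic C m \<and> Cod C m = X} // subobject_rel C X"

definition subobject :: "('o, 'm, 'z) category_scheme \<Rightarrow> 'm \<Rightarrow> 'm set" where
  "subobject C m = subobject_rel C (Cod C m) `` {m}"

definition sub_le :: "('o, 'm, 'z) category_scheme \<Rightarrow> 'm set \<Rightarrow> 'm set \<Rightarrow> bool" where
  "sub_le C M N \<longleftrightarrow> (\<exists>m \<in> M. \<exists>n \<in> N. \<exists>h \<in> Hom C (Dom C m) (Dom C n). m = n \<cdot>\<^bsub>C\<^esub> h)"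

definition ClSub :: "('o, 'm, 'z) dagger_category_scheme \<Rightarrow> 'o \<Rightarrow> 'm set gorder" where
  "ClSub C X = \<lparr>carrier = {M \<in> Sub C X. \<exists>m \<in> M. dagger_mono C m}, eq = (=), le = sub_le C\<rparr>"

text \<open>In the next three definitions \<^emph>\<open>THE\<close> ranges over the subobjects obtained from all choices
  (of a factorisation, of a dagger-mono representative, of a dagger-mono kernel). In a pre-Hilbert
  category every choice gives the same subobject.\<close>

definition Im :: "('o, 'm, 'z) dagger_category_scheme \<Rightarrow> 'm \<Rightarrow> 'm set" where
  "Im C h = (THE S. \<exists>m e. dagger_mono C m \<and> is_epic C e \<and> Dom C m = Cod C e \<and>
    h = m \<cdot>\<^bsub>C\<^esub> e \<and> S = subobject C m)"

definition exists_along :: "('o, 'm, 'z) dagger_category_scheme \<Rightarrow> 'm \<Rightarrow> 'm set \<Rightarrow> 'm set" where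
  "exists_along C f M = (THE S. \<exists>m \<in> M. dagger_mono C m \<and> S = Im C (f \<cdot>\<^bsub>C\<^esub> m))"

definition perp :: "('o, 'm, 'z) dagger_category_scheme \<Rightarrow> 'm set \<Rightarrow> 'm set" where
  "perp C M = (THE S. \<exists>m \<in> M. dagger_mono C m \<and>
    (\<exists>k. dagger_mono C k \<and> is_kernel C k (Dag C m) \<and> S = subobject C k))"

definition arr_perp :: "('o, 'm, 'z) dagger_category_scheme \<Rightarrow> 'm \<Rightarrow> 'm set \<Rightarrow> 'm set" where
  "arr_perp C f = perp C \<circ> exists_along C f"

end

theory Submission
  imports Defs
begin

text \<open>A subobject represented by a dagger-mono \<open>n\<close> lies below \<open>(\<exists>\<^sub>f M)\<^sup>\<bottom>\<close> iff
  \<open>m\<^sup>\<dagger> f\<^sup>\<dagger> n = 0\<close>, where \<open>m\<close> represents \<open>M\<close>: write \<open>f m = p e\<close> with \<open>p\<close> a dagger-mono and \<open>e\<close>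
  epi; then \<open>n\<close> factors through \<open>ker p\<^sup>\<dagger>\<close> iff \<open>p\<^sup>\<dagger> n = 0\<close>, and the epi \<open>e\<close> can be cancelled. The
  dagger of this condition is the corresponding one for \<open>f\<^sup>\<dagger>\<close> with \<open>M\<close> and \<open>N\<close> exchanged.

  The factorisation of \<open>h\<close> takes \<open>p = ker (k\<^sup>\<dagger>)\<close> with \<open>k = ker h\<^sup>\<dagger>\<close>. If \<open>g e = g' e\<close>, then the
  equaliser \<open>n\<close> of \<open>g, g'\<close> is such that \<open>p n\<close> is again a dagger-mono through which \<open>h\<close> factors.
  It is the kernel of some \<open>d\<close>, and \<open>d h = 0\<close> forces \<open>d p = 0\<close>, so \<open>n\<close> is split epi and
  \<open>g = g'\<close>.\<close>

text \<open>Arbitrary arrows are allowed, not only monos: the same relation orders representatives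
  of subobjects and says that an arrow such as \<open>f \<cdot> m\<close> lands in a given
  subobject.\<close>

definition factors_through :: "('o, 'm, 'z) category_scheme \<Rightarrow> 'm \<Rightarrow> 'm \<Rightarrow> bool" where
  "factors_through C m n \<longleftrightarrow> (\<exists>h \<in> Hom C (Dom C m) (Dom C n). m = n \<cdot>\<^bsub>C\<^esub> h)"

section \<open>Factorisation and zero morphisms\<close>

context category
begin

section \<open>Composition and the factorisation preorder on arrows\<close>

lemma Comp_Arr [simp]:
  assumes "f \<in> Arr C" "g \<in> Arr C" "Dom C g = Cod C f"
  shows "g \<cdot> f \<in> Arr C" "Dom C (g \<cdot> f) = Dom C f" "Cod C (g \<cdot> f) = Cod C g"
  using Comp_closed[of f "Dom C f" "Cod C f" g "Cod C g"] assms by (auto simp: Hom_def)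

lemma Comp_assoc_Arr [simp]:
  "\<lbrakk>f \<in> Arr C; g \<in> Arr C; h \<in> Arr C; Dom C g = Cod C f; Dom C h = Cod C g\<rbrakk> \<Longrightarrow>
    (h \<cdot> g) \<cdot> f = h \<cdot> (g \<cdot> f)"
  by (rule Comp_assoc) (auto simp: Hom_def)

lemma Id_Arr [simp]:
  assumes "A \<in> Obj C"
  shows "Id C A \<in> Arr C" "Dom C (Id C A) = A" "Cod C (Id C A) = A"
  using Id_closed[OF assms] by (auto simp: Hom_def)

lemma Comp_Id [simp]:
  assumes "f \<in> Arr C"
  shows "Cod C f = A \<Longrightarrow> Id C A \<cdot> f = f" "Dom C f = A \<Longrightarrow> f \<cdot> Id C A = f"
  using assms by (auto intro: Id_left Id_right simp: Hom_def)

lemma factors_throughE: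
  assumes "factors_through C m n"
  obtains h where "h \<in> Arr C" "Dom C h = Dom C m" "Cod C h = Dom C n" "n \<cdot> h = m"
  using assms unfolding factors_through_def Hom_def by blast

lemma factors_throughI:
  "\<lbrakk>h \<in> Arr C; Cod C h = Dom C n; n \<in> Arr C; n \<cdot> h = m\<rbrakk> \<Longrightarrow> factors_through C m n"
  by (auto simp: factors_through_def Hom_def)

lemma factors_through_refl: "m \<in> Arr C \<Longrightarrow> factors_through C m m"
  by (rule factors_throughI[of "Id C (Dom C m)"]) (auto simp: Dom_closed)

lemma factors_through_trans:
  assumes "factors_through C l m" "factors_through C m n" "n \<in> Arr C"
  shows "factors_through C l n"
proof -
  obtain h where h: "h \<in> Arr C" "Dom C h = Dom C l" "Cod C h = Dom C m" "m \<cdot> h = l"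
    using assms(1) by (rule factors_throughE)
  obtain i where i: "i \<in> Arr C" "Dom C i = Dom C m" "Cod C i = Dom C n" "n \<cdot> i = m"
    using assms(2) by (rule factors_throughE)
  have "n \<cdot> (i \<cdot> h) = l"
    using Comp_assoc_Arr[of h i n] h i assms(3) by simp
  then show ?thesis
    using h i assms(3) by (intro factors_throughI[of "i \<cdot> h"]) auto
qed

lemma factors_through_Comp_left:
  assumes "factors_through C m n" "n \<in> Arr C" "f \<in> Arr C" "Dom C f = Cod C n"
  shows "factors_through C (f \<cdot> m) (f \<cdot> n)"
proof -
  obtain h where h: "h \<in> Arr C" "Dom C h = Dom C m" "Cod C h = Dom C n" "n \<cdot> h = m"
    using assms(1) by (rule factors_throughE)
  moreover have "(f \<cdot> n) \<cdot> h = f \<cdot> m"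
    using h assms(2-4) by simp
  ultimately show ?thesis
    using assms(2-4) by (intro factors_throughI[of h]) auto
qed

section \<open>Monos, epis and subobjects\<close>

lemma is_monicD:
  "\<lbrakk>is_monic C m; g \<in> Arr C; h \<in> Arr C; Cod C g = Dom C m; Cod C h = Dom C m;
    Dom C g = Dom C h; m \<cdot> g = m \<cdot> h\<rbrakk> \<Longrightarrow> g = h"
  unfolding is_monic_def Hom_def by blast

lemma is_epicD:
  "\<lbrakk>is_epic C e; g \<in> Arr C; h \<in> Arr C; Dom C g = Cod C e; Dom C h = Cod C e;
    Cod C g = Cod C h; g \<cdot> e = h \<cdot> e\<rbrakk> \<Longrightarrow> g = h"
  unfolding is_epic_def Hom_def by blast

text \<open>For monos, mutual factorisation already yields an isomorphism of domains: from
  \<open>n \<cdot> u = m\<close> and \<open>m \<cdot> v = n\<close> one gets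
  \<open>m \<cdot> (v \<cdot> u) = m\<close>, and cancelling \<open>m\<close> shows that
  \<open>v\<close> is a left inverse of \<open>u\<close>; cancelling \<open>n\<close> gives the
  other side. Subobjects are thus classes of the factorisation preorder.\<close>

lemma subobject_rel_iff:
  "(m, n) \<in> subobject_rel C X \<longleftrightarrow> is_monic C m \<and> is_monic C n \<and> Cod C m = X \<and> Cod C n = X \<and>
    factors_through C m n \<and> factors_through C n m"
proof (cases "is_monic C m \<and> is_monic C n \<and> Cod C m = X \<and> Cod C n = X")
  case True
  then have m: "is_monic C m" "m \<in> Arr C" and n: "is_monic C n" "n \<in> Arr C"
    and X: "Cod C m = X" "Cod C n = X"
    by (auto simp: is_monic_def)
  have "(\<exists>u \<in> Hom C (Dom C m) (Dom C n). is_iso C u \<and> m = n \<cdot> u) \<longleftrightarrow>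
    factors_through C m n \<and> factors_through C n m"
  proof
    assume "\<exists>u \<in> Hom C (Dom C m) (Dom C n). is_iso C u \<and> m = n \<cdot> u"
    then obtain u v where u: "u \<in> Arr C" "Dom C u = Dom C m" "Cod C u = Dom C n" "n \<cdot> u = m"
      and v: "v \<in> Arr C" "Dom C v = Dom C n" "Cod C v = Dom C m" "u \<cdot> v = Id C (Dom C n)"
      unfolding is_iso_def Hom_def by (metis (mono_tags, lifting) mem_Collect_eq)
    have "m \<cdot> v = n"
      using Comp_assoc_Arr[of v u n] u v n by simp
    then show "factors_through C m n \<and> factors_through C n m"
      using factors_throughI[of u n m] factors_throughI[of v m n] u v m n by simp
  next
    assume "factors_through C m n \<and> factors_through C n m"
    then obtain u v where u: "u \<in> Arr C" "Dom C u = Dom C m" "Cod C u = Dom C n" "n \<cdot> u = m"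
      and v: "v \<in> Arr C" "Dom C v = Dom C n" "Cod C v = Dom C m" "m \<cdot> v = n"
      by (blast elim: factors_throughE)
    have "m \<cdot> (v \<cdot> u) = (m \<cdot> v) \<cdot> u"
      using u(1-3) v(1-3) m by simp
    also have "\<dots> = m \<cdot> Id C (Dom C m)"
      using u(4) v(4) m(2) by simp
    finally have "v \<cdot> u = Id C (Dom C m)"
      by (rule is_monicD[OF m(1), rotated -1]) (use u(1-3) v(1-3) m in \<open>auto simp: Dom_closed\<close>)
    moreover have "u \<cdot> v = Id C (Dom C n)"
    proof -
      have "n \<cdot> (u \<cdot> v) = (n \<cdot> u) \<cdot> v"
        using u(1-3) v(1-3) n by simp
      also have "\<dots> = n \<cdot> Id C (Dom C n)"
        using u(4) v(4) n(2) by simp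
      finally show ?thesis
        by (rule is_monicD[OF n(1), rotated -1]) (use u(1-3) v(1-3) n in \<open>auto simp: Dom_closed\<close>)
    qed
    ultimately have "is_iso C u"
      using u(1-3) v(1-3) by (auto simp: Hom_def is_iso_def)
    then show "\<exists>u \<in> Hom C (Dom C m) (Dom C n). is_iso C u \<and> m = n \<cdot> u"
      using u by (auto simp: Hom_def)
  qed
  then show ?thesis
    using True by (auto simp: subobject_rel_def)
qed (auto simp: subobject_rel_def)

lemma mem_subobject_iff:
  assumes "is_monic C m"
  shows "m' \<in> subobject C m \<longleftrightarrow> is_monic C m' \<and> Cod C m' = Cod C m \<and>
    factors_through C m m' \<and> factors_through C m' m"
  using assms by (auto simp: subobject_def subobject_rel_iff)

lemma subobject_eqI:
  assumes "is_monic C m" "is_monic C n" "Cod C m = Cod C n"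
    "factors_through C m n" "factors_through C n m"
  shows "subobject C m = subobject C n"
proof -
  have "m \<in> Arr C" "n \<in> Arr C"
    using assms by (auto simp: is_monic_def)
  then show ?thesis
    using assms unfolding set_eq_iff mem_subobject_iff[OF assms(1)] mem_subobject_iff[OF assms(2)]
    by (metis factors_through_trans is_monic_def)
qed

lemma self_mem_subobject: "is_monic C m \<Longrightarrow> m \<in> subobject C m"
  by (simp add: mem_subobject_iff factors_through_refl is_monic_def)

text \<open>All representatives of a class factor through each other, so by transitivity the
  existential choice of representatives in \<open>sub_le\<close> can be replaced by the given
  generators.\<close>

lemma sub_le_subobject_iff:
  assumes "is_monic C m" "is_monic C n"
  shows "sub_le C (subobject C m) (subobject C n) \<longleftrightarrow> factors_through C m n"
proof
  assume "sub_le C (subobject C m) (subobject C n)"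
  then obtain m' n' where "m' \<in> subobject C m" "n' \<in> subobject C n" "factors_through C m' n'"
    by (auto simp: sub_le_def factors_through_def)
  then show "factors_through C m n"
    using assms by (auto simp: mem_subobject_iff is_monic_def intro: factors_through_trans)
next
  assume "factors_through C m n"
  then show "sub_le C (subobject C m) (subobject C n)"
    using assms by (auto simp: sub_le_def factors_through_def intro!: bexI[OF _ self_mem_subobject])
qed

section \<open>Zero arrows\<close>

lemma is_zero_arrE:
  assumes "is_zero_arr C f"
  obtains Z a b where "f \<in> Arr C" "is_zero_object C Z" "a \<in> Arr C" "Dom C a = Dom C f"
    "Cod C a = Z" "b \<in> Arr C" "Dom C b = Z" "Cod C b = Cod C f" "b \<cdot> a = f"
  using assms unfolding is_zero_arr_def Hom_def by blast

lemma is_zero_arrI: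
  assumes "is_zero_object C Z" "a \<in> Arr C" "Cod C a = Z" "b \<in> Arr C" "Dom C b = Z" "b \<cdot> a = f"
  shows "is_zero_arr C f"
proof -
  have "f \<in> Arr C" "Dom C f = Dom C a" "Cod C f = Cod C b"
    using assms by auto
  then show ?thesis
    using assms unfolding is_zero_arr_def Hom_def
    by (auto intro!: exI[of _ Z] bexI[of _ a] bexI[of _ b])
qed

lemma is_zero_arr_Comp_right:
  assumes "is_zero_arr C f" "g \<in> Arr C" "Cod C g = Dom C f"
  shows "is_zero_arr C (f \<cdot> g)"
proof -
  obtain Z a b where *: "f \<in> Arr C" "is_zero_object C Z" "a \<in> Arr C" "Dom C a = Dom C f"
    "Cod C a = Z" "b \<in> Arr C" "Dom C b = Z" "Cod C b = Cod C f" "b \<cdot> a = f"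
    using assms(1) by (rule is_zero_arrE)
  moreover have "b \<cdot> (a \<cdot> g) = f \<cdot> g"
    using Comp_assoc_Arr[of g a b] * assms(2,3) by simp
  ultimately show ?thesis
    using assms(2,3) by (intro is_zero_arrI[of Z "a \<cdot> g" b]) auto
qed

lemma is_zero_arr_Comp_left:
  assumes "is_zero_arr C f" "g \<in> Arr C" "Dom C g = Cod C f"
  shows "is_zero_arr C (g \<cdot> f)"
proof -
  obtain Z a b where *: "f \<in> Arr C" "is_zero_object C Z" "a \<in> Arr C" "Dom C a = Dom C f"
    "Cod C a = Z" "b \<in> Arr C" "Dom C b = Z" "Cod C b = Cod C f" "b \<cdot> a = f"
    using assms(1) by (rule is_zero_arrE)
  moreover have "(g \<cdot> b) \<cdot> a = g \<cdot> f"
    using * assms(2,3) by simp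
  ultimately show ?thesis
    using assms(2,3) by (intro is_zero_arrI[of Z a "g \<cdot> b"]) auto
qed

text \<open>The two arrows may pass through different zero objects \<open>Z\<close> and
  \<open>Z'\<close>. An arrow \<open>u\<close> between these satisfies
  \<open>u \<cdot> a = a'\<close> because \<open>Z'\<close> is terminal and
  \<open>b' \<cdot> u = b\<close> because \<open>Z\<close> is initial, so both arrows equal
  \<open>b' \<cdot> u \<cdot> a\<close>.\<close>

lemma is_zero_arr_unique:
  assumes "is_zero_arr C f" "is_zero_arr C g" "Dom C f = Dom C g" "Cod C f = Cod C g"
  shows "f = g"
proof -
  obtain Z a b where Z: "is_zero_object C Z" and a: "a \<in> Hom C (Dom C f) Z"
    and b: "b \<in> Hom C Z (Cod C f)" and f: "f = b \<cdot> a"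
    using assms(1) by (auto simp: is_zero_arr_def)
  obtain Z' a' b' where Z': "is_zero_object C Z'" and a': "a' \<in> Hom C (Dom C f) Z'"
    and b': "b' \<in> Hom C Z' (Cod C f)" and g: "g = b' \<cdot> a'"
    using assms(2-4) by (auto simp: is_zero_arr_def)
  have obj: "Dom C f \<in> Obj C" "Cod C f \<in> Obj C" "Z \<in> Obj C"
    using assms(1) Z by (auto simp: is_zero_arr_def is_zero_object_def Dom_closed Cod_closed)
  then obtain u where u: "u \<in> Hom C Z Z'"
    using Z' unfolding is_zero_object_def by blast
  have "u \<cdot> a = a'"
    using Comp_closed[OF a u] a' obj Z' unfolding is_zero_object_def by blast
  moreover have "b' \<cdot> u = b"
    using Comp_closed[OF u b'] b obj Z unfolding is_zero_object_def by blast
  ultimately show ?thesis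
    using Comp_assoc[OF a u b'] f g by simp
qed

section \<open>Equalisers and kernels in terms of factorisation\<close>

lemma is_equaliser_factors_through:
  assumes "is_equaliser C n f g" "e \<in> Arr C" "Cod C e = Cod C n" "f \<cdot> e = g \<cdot> e"
  shows "factors_through C e n"
proof -
  have "e \<in> Hom C (Dom C e) (Cod C n)"
    using assms(2,3) by (simp add: Hom_def)
  moreover have "\<forall>A. \<forall>h \<in> Hom C A (Cod C n). f \<cdot> h = g \<cdot> h \<longrightarrow>
      (\<exists>!u. u \<in> Hom C A (Dom C n) \<and> n \<cdot> u = h)"
    using assms(1) unfolding is_equaliser_def by (elim conjE)
  ultimately have "\<exists>!u. u \<in> Hom C (Dom C e) (Dom C n) \<and> n \<cdot> u = e"
    using assms(4) by simp
  then show ?thesis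
    unfolding factors_through_def by metis
qed

text \<open>This is the bridge by which every order question between subobjects becomes the
  vanishing of a composite. One direction is the universal property, the other the stability of zero
  arrows under precomposition.\<close>

lemma is_kernel_factors_through_iff:
  assumes "is_kernel C k f" "g \<in> Arr C" "Cod C g = Dom C f"
  shows "factors_through C g k \<longleftrightarrow> is_zero_arr C (f \<cdot> g)"
proof
  have k: "k \<in> Arr C" "f \<in> Arr C" "Cod C k = Dom C f" "is_zero_arr C (f \<cdot> k)"
    using assms(1) by (auto simp: is_kernel_def)
  assume "factors_through C g k"
  then obtain h where h: "h \<in> Arr C" "Dom C h = Dom C g" "Cod C h = Dom C k" "k \<cdot> h = g"
    by (rule factors_throughE)
  then show "is_zero_arr C (f \<cdot> g)"
    using is_zero_arr_Comp_right[of "f \<cdot> k" h] k by simp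
next
  assume *: "is_zero_arr C (f \<cdot> g)"
  have "g \<in> Hom C (Dom C g) (Dom C f)"
    using assms(2,3) by (simp add: Hom_def)
  moreover have "\<forall>A. \<forall>g \<in> Hom C A (Dom C f). is_zero_arr C (f \<cdot> g) \<longrightarrow>
      (\<exists>!h. h \<in> Hom C A (Dom C k) \<and> k \<cdot> h = g)"
    using assms(1) unfolding is_kernel_def by (elim conjE)
  ultimately have "\<exists>!h. h \<in> Hom C (Dom C g) (Dom C k) \<and> k \<cdot> h = g"
    using * by simp
  then show "factors_through C g k"
    unfolding factors_through_def by metis
qed

end


section \<open>Kernels and images in a pre-Hilbert category\<close>

context dagger_category
begin

section \<open>The dagger and its effect on zero arrows\<close>

lemma Dag_Arr [simp]:
  assumes "f \<in> Arr C"
  shows "Dag C f \<in> Arr C" "Dom C (Dag C f) = Cod C f" "Cod C (Dag C f) = Dom C f"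
    "Dag C (Dag C f) = f"
  using Dag_closed[of f "Dom C f" "Cod C f"] assms by (auto simp: Hom_def Dag_Dag)

lemma Dag_Comp_Arr [simp]:
  "\<lbrakk>f \<in> Arr C; g \<in> Arr C; Dom C g = Cod C f\<rbrakk> \<Longrightarrow> Dag C (g \<cdot> f) = Dag C f \<cdot> Dag C g"
  by (rule Dag_Comp) (auto simp: Hom_def)

lemma is_zero_arr_Dag:
  assumes "is_zero_arr C f"
  shows "is_zero_arr C (Dag C f)"
proof -
  obtain Z a b where *: "f \<in> Arr C" "is_zero_object C Z" "a \<in> Arr C" "Dom C a = Dom C f"
    "Cod C a = Z" "b \<in> Arr C" "Dom C b = Z" "Cod C b = Cod C f" "b \<cdot> a = f"
    using assms by (rule is_zero_arrE)
  moreover have "Dag C a \<cdot> Dag C b = Dag C f"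
    using Dag_Comp_Arr[of a b] * by simp
  ultimately show ?thesis
    by (intro is_zero_arrI[of Z "Dag C b" "Dag C a"]) auto
qed

lemma is_zero_arr_Dag_iff: "f \<in> Arr C \<Longrightarrow> is_zero_arr C (Dag C f) \<longleftrightarrow> is_zero_arr C f"
  by (metis Dag_Dag is_zero_arr_Dag)

section \<open>Dagger-monos and the poset \<open>ClSub\<close>\<close>

lemma dagger_mono_imp_monic:
  assumes "dagger_mono C m"
  shows "is_monic C m"
proof -
  have m: "m \<in> Arr C" "Dag C m \<cdot> m = Id C (Dom C m)"
    using assms by (auto simp: dagger_mono_def)
  have "g = h" if "g \<in> Arr C" "h \<in> Arr C" "Cod C g = Dom C m" "Cod C h = Dom C m"
    "m \<cdot> g = m \<cdot> h" for g h
    using Comp_assoc_Arr[of g m "Dag C m"] Comp_assoc_Arr[of h m "Dag C m"] m that by simp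
  then show ?thesis
    using m by (auto simp: is_monic_def Hom_def)
qed

lemma dagger_mono_Comp:
  assumes "dagger_mono C m" "dagger_mono C n" "Dom C m = Cod C n"
  shows "dagger_mono C (m \<cdot> n)"
proof -
  have m: "m \<in> Arr C" "Dag C m \<cdot> m = Id C (Dom C m)" and n: "n \<in> Arr C" "Dag C n \<cdot> n = Id C (Dom C n)"
    using assms by (auto simp: dagger_mono_def)
  have "Dag C m \<cdot> (m \<cdot> n) = n"
    using Comp_assoc_Arr[of n m "Dag C m"] m n(1) assms(3) by simp
  then show ?thesis
    using m n assms(3) by (simp add: dagger_mono_def)
qed

text \<open>By definition the class is generated by some mono and merely contains a dagger-mono.
  Equivalent monos generate the same class, so the dagger-mono itself may serve as the generator;
  all later arguments start from such a representative.\<close>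

lemma ClSub_carrier_iff:
  "M \<in> carrier (ClSub C X) \<longleftrightarrow> (\<exists>m. dagger_mono C m \<and> Cod C m = X \<and> M = subobject C m)"
proof
  assume "M \<in> carrier (ClSub C X)"
  then obtain n m where n: "is_monic C n" "Cod C n = X" "M = subobject C n"
    and m: "m \<in> M" "dagger_mono C m"
    by (auto simp: ClSub_def Sub_def subobject_def quotient_def)
  moreover from this have "subobject C m = subobject C n"
    by (intro subobject_eqI) (auto simp: mem_subobject_iff)
  ultimately show "\<exists>m. dagger_mono C m \<and> Cod C m = X \<and> M = subobject C m"
    by (auto simp: mem_subobject_iff)
next
  assume "\<exists>m. dagger_mono C m \<and> Cod C m = X \<and> M = subobject C m"
  then show "M \<in> carrier (ClSub C X)"
    using self_mem_subobject dagger_mono_imp_monic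
    by (auto simp: ClSub_def Sub_def subobject_def quotient_def)
qed

lemma le_ClSub: "(\<sqsubseteq>\<^bsub>ClSub C X\<^esub>) = sub_le C"
  by (simp add: ClSub_def)

text \<open>Factorisation is only a preorder on monos. Antisymmetry appears on classes, where mutual
  factorisation is equality.\<close>

lemma partial_order_ClSub: "partial_order (ClSub C X)"
proof -
  have *: "M \<in> carrier (ClSub C X) \<Longrightarrow> \<exists>m. is_monic C m \<and> Cod C m = X \<and> M = subobject C m" for M
    by (auto simp: ClSub_carrier_iff intro: dagger_mono_imp_monic)
  have refl: "sub_le C M M" if "M \<in> carrier (ClSub C X)" for M
    using *[OF that] by (auto simp: sub_le_subobject_iff factors_through_refl is_monic_def)
  have antisym: "M = N" if MN: "M \<in> carrier (ClSub C X)" "N \<in> carrier (ClSub C X)"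
    and le: "sub_le C M N" "sub_le C N M" for M N
  proof -
    obtain m n where m: "is_monic C m" "Cod C m = X" "M = subobject C m"
      and n: "is_monic C n" "Cod C n = X" "N = subobject C n"
      using *[OF MN(1)] *[OF MN(2)] by blast
    then have "factors_through C m n" "factors_through C n m"
      using le by (simp_all add: sub_le_subobject_iff)
    then show "M = N"
      unfolding m(3) n(3) by (intro subobject_eqI) (use m n in auto)
  qed
  have trans: "sub_le C L N" if "L \<in> carrier (ClSub C X)" "M \<in> carrier (ClSub C X)"
    "N \<in> carrier (ClSub C X)" "sub_le C L M" "sub_le C M N" for L M N
    using *[OF that(1)] *[OF that(2)] *[OF that(3)] that(4,5)
    by (auto simp: sub_le_subobject_iff is_monic_def intro: factors_through_trans)
  have eq: "eq (ClSub C X) = (=)"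
    by (simp add: ClSub_def)
  show ?thesis
    by (unfold_locales, unfold le_ClSub eq) (metis refl antisym trans)+
qed

end

context pre_hilbert_category
begin

section \<open>Zero arrows and dagger kernels in a pre-Hilbert category\<close>

lemma zero_arr_exists:
  assumes "A \<in> Obj C" "B \<in> Obj C"
  obtains z where "is_zero_arr C z" "Dom C z = A" "Cod C z = B"
proof -
  obtain Z where Z: "is_zero_object C Z"
    using zero_object by blast
  then obtain a b where ab: "a \<in> Hom C A Z" "b \<in> Hom C Z B"
    using assms unfolding is_zero_object_def by blast
  then have "b \<cdot> a \<in> Hom C A B"
    by (rule Comp_closed)
  then show thesis
    using that[of "b \<cdot> a"] Z ab by (auto simp: is_zero_arr_def Hom_def)
qed

text \<open>Without subtraction, cancellation needs a second arrow to compare with: a zero arrow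
  \<open>z\<close> parallel to \<open>g\<close>. If \<open>g \<cdot> e\<close> is zero, it equals
  \<open>z \<cdot> e\<close> by uniqueness of zero arrows, and the epi gives
  \<open>g = z\<close>.\<close>

lemma is_epic_zero_arr_iff:
  assumes "is_epic C e" "g \<in> Arr C" "Dom C g = Cod C e"
  shows "is_zero_arr C (g \<cdot> e) \<longleftrightarrow> is_zero_arr C g"
proof
  have e: "e \<in> Arr C"
    using assms(1) by (simp add: is_epic_def)
  obtain z where z: "is_zero_arr C z" "Dom C z = Dom C g" "Cod C z = Cod C g"
    using zero_arr_exists[of "Dom C g" "Cod C g"] Dom_closed Cod_closed assms(2) by blast
  then have Arr: "z \<in> Arr C"
    by (simp add: is_zero_arr_def)
  assume "is_zero_arr C (g \<cdot> e)"
  moreover have "is_zero_arr C (z \<cdot> e)"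
    using z e assms(3) by (intro is_zero_arr_Comp_right) auto
  ultimately have "g \<cdot> e = z \<cdot> e"
    by (rule is_zero_arr_unique) (use z Arr e assms in simp_all)
  then have "g = z"
    by (rule is_epicD[OF assms(1), rotated -1]) (use assms z Arr in auto)
  then show "is_zero_arr C g"
    using z by simp
next
  assume "is_zero_arr C g"
  then show "is_zero_arr C (g \<cdot> e)"
    using assms by (intro is_zero_arr_Comp_right) (auto simp: is_epic_def)
qed

text \<open>The kernel is the dagger equaliser of \<open>f\<close> and a parallel zero arrow
  \<open>z\<close>. By uniqueness of zero arrows, \<open>f \<cdot> g\<close> is zero exactly when
  \<open>g\<close> equalises \<open>f\<close> and \<open>z\<close>, so the two universal properties
  agree.\<close>

lemma dagger_kernel_exists:
  assumes "f \<in> Arr C"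
  obtains k where "dagger_mono C k" "is_kernel C k f"
proof -
  obtain z where z: "is_zero_arr C z" "Dom C z = Dom C f" "Cod C z = Cod C f"
    using zero_arr_exists[of "Dom C f" "Cod C f"] Dom_closed Cod_closed assms by blast
  then have Arr: "z \<in> Arr C"
    by (simp add: is_zero_arr_def)
  then obtain k where k: "is_equaliser C k f z" "dagger_mono C k"
    using dagger_equalisers[of f "Dom C f" "Cod C f" z] z assms by (auto simp: Hom_def)
  have "k \<in> Arr C" "Cod C k = Dom C f" "f \<cdot> k = z \<cdot> k"
    using k by (auto simp: is_equaliser_def Hom_def)
  moreover from this have "is_zero_arr C (f \<cdot> k)"
    using is_zero_arr_Comp_right[of z k] z by simp
  moreover have "f \<cdot> g = z \<cdot> g" if "g \<in> Arr C" "Cod C g = Dom C f" "is_zero_arr C (f \<cdot> g)" for g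
    using is_zero_arr_unique[of "f \<cdot> g" "z \<cdot> g"] is_zero_arr_Comp_right[of z g] that z Arr assms
    by simp
  ultimately have "is_kernel C k f"
    using k(1) assms by (auto simp: is_kernel_def is_equaliser_def Hom_def)
  then show thesis
    using that k(2) by blast
qed

section \<open>Epi and dagger-mono factorisation, and minimality of the image\<close>

lemma epi_dagger_mono_factorisation:
  assumes h: "h \<in> Arr C"
  obtains m e where "dagger_mono C m" "is_epic C e" "Dom C m = Cod C e" "h = m \<cdot> e"
proof -
  obtain k where k: "dagger_mono C k" "is_kernel C k (Dag C h)"
    using dagger_kernel_exists[of "Dag C h"] h by auto
  have kA: "k \<in> Arr C" "Cod C k = Cod C h" "is_zero_arr C (Dag C h \<cdot> k)"
    using k h by (auto simp: is_kernel_def)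
  obtain m where m: "dagger_mono C m" "is_kernel C m (Dag C k)"
    using dagger_kernel_exists[of "Dag C k"] kA by auto
  have mA: "m \<in> Arr C" "Cod C m = Cod C h" "is_zero_arr C (Dag C k \<cdot> m)"
    using m kA by (auto simp: is_kernel_def)
  \<comment> \<open>The dagger of \<open>h\<^sup>\<dagger> k = 0\<close> is
    \<open>k\<^sup>\<dagger> h = 0\<close>, so \<open>h\<close> factors through the kernel
    \<open>m\<close> of \<open>k\<^sup>\<dagger>\<close>.\<close>
  have "is_zero_arr C (Dag C k \<cdot> h)"
    using is_zero_arr_Dag[OF kA(3)] kA h by simp
  then have "factors_through C h m"
    using is_kernel_factors_through_iff[OF m(2)] h kA by simp
  then obtain e where e: "e \<in> Arr C" "Dom C e = Dom C h" "Cod C e = Dom C m" "m \<cdot> e = h"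
    by (rule factors_throughE)
  have "g = g'" if g: "g \<in> Hom C (Cod C e) B" "g' \<in> Hom C (Cod C e) B" "g \<cdot> e = g' \<cdot> e" for B g g'
  proof -
    obtain n where n: "is_equaliser C n g g'" "dagger_mono C n"
      using dagger_equalisers[OF g(1,2)] by blast
    have nA: "n \<in> Arr C" "Cod C n = Cod C e" "g \<cdot> n = g' \<cdot> n"
      using n g by (auto simp: is_equaliser_def Hom_def)
    have gA: "g \<in> Arr C" "g' \<in> Arr C" "Dom C g = Dom C m" "Dom C g' = Dom C m"
      using g e by (auto simp: Hom_def)
    have "factors_through C e n"
      using is_equaliser_factors_through[OF n(1)] e(1) nA(2) g(3) by simp
    then have h_mn: "factors_through C h (m \<cdot> n)"
      using factors_through_Comp_left[of e n m] e nA mA by simp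
    have mn: "dagger_mono C (m \<cdot> n)"
      using m n nA e by (intro dagger_mono_Comp) auto
    then obtain d where d: "is_kernel C (m \<cdot> n) d"
      using dagger_mono_kernel by blast
    have dA: "d \<in> Arr C" "Dom C d = Cod C h"
      using d nA mA e by (auto simp: is_kernel_def)
    have "is_zero_arr C (d \<cdot> h)"
      using is_kernel_factors_through_iff[OF d] h_mn h dA by simp
    \<comment> \<open>From \<open>d h = 0\<close> the dagger gives
      \<open>h\<^sup>\<dagger> d\<^sup>\<dagger> = 0\<close>. Hence
      \<open>d\<^sup>\<dagger> = k t\<close> because \<open>k\<close> is the kernel of
      \<open>h\<^sup>\<dagger>\<close>, so \<open>d = t\<^sup>\<dagger> k\<^sup>\<dagger>\<close>,
      and \<open>d m = 0\<close> follows from \<open>k\<^sup>\<dagger> m = 0\<close>.\<close>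
    then have "is_zero_arr C (Dag C h \<cdot> Dag C d)"
      using is_zero_arr_Dag[of "d \<cdot> h"] h dA by simp
    then have "factors_through C (Dag C d) k"
      using is_kernel_factors_through_iff[OF k(2)] h dA by simp
    then obtain t where t: "t \<in> Arr C" "Dom C t = Cod C d" "Cod C t = Dom C k" "k \<cdot> t = Dag C d"
      using dA by (auto elim!: factors_throughE)
    have "d = Dag C t \<cdot> Dag C k"
      using t kA dA by (metis Dag_Comp_Arr Dag_Dag)
    then have "is_zero_arr C (d \<cdot> m)"
      using is_zero_arr_Comp_left[OF mA(3), of "Dag C t"] t kA mA by simp
    then have "factors_through C m (m \<cdot> n)"
      using is_kernel_factors_through_iff[OF d] mA dA by simp
    \<comment> \<open>Cancelling the mono \<open>m\<close> in \<open>m n s = m\<close> makes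
      \<open>s\<close> a right inverse of \<open>n\<close>, and then
      \<open>g = g n s = g' n s = g'\<close>.\<close>
    then obtain s where s: "s \<in> Arr C" "Dom C s = Dom C m" "Cod C s = Dom C n" "(m \<cdot> n) \<cdot> s = m"
      using nA mA e(3) by (metis Comp_Arr(2) factors_throughE)
    then have "m \<cdot> (n \<cdot> s) = m \<cdot> Id C (Dom C m)"
      using nA mA e(3) by simp
    then have "n \<cdot> s = Id C (Dom C m)"
      by (rule is_monicD[OF dagger_mono_imp_monic[OF m(1)], rotated -1])
        (use s(1-3) nA mA e in \<open>auto simp: Dom_closed\<close>)
    then have "g = (g \<cdot> n) \<cdot> s" "g' = (g' \<cdot> n) \<cdot> s"
      using s(1-3) nA(1,2) gA e(3) by auto
    then show "g = g'"
      using nA(3) by simp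
  qed
  then have "is_epic C e"
    using e(1) by (auto simp: is_epic_def)
  then show thesis
    using that m(1) e by auto
qed

text \<open>Since \<open>n\<close> is the kernel of some \<open>d\<close>, the assumption says that
  \<open>d m e\<close> is zero. The epi \<open>e\<close> cancels, leaving \<open>d m = 0\<close>.
  When \<open>m\<close> is a dagger-mono, this is the minimality of the image of
  \<open>m e\<close>.\<close>

lemma factors_through_image_least:
  assumes n: "dagger_mono C n" and e: "is_epic C e" and m: "m \<in> Arr C" "Dom C m = Cod C e"
    "Cod C m = Cod C n" and le: "factors_through C (m \<cdot> e) n"
  shows "factors_through C m n"
proof -
  obtain d where d: "is_kernel C n d"
    using dagger_mono_kernel[OF n] by blast
  have A: "d \<in> Arr C" "Dom C d = Cod C n" "e \<in> Arr C"
    using d e by (auto simp: is_kernel_def is_epic_def)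
  have "is_zero_arr C (d \<cdot> (m \<cdot> e))"
    using is_kernel_factors_through_iff[OF d] le m A by simp
  then have "is_zero_arr C (d \<cdot> m)"
    using is_epic_zero_arr_iff[OF e, of "d \<cdot> m"] m A by simp
  then show ?thesis
    using is_kernel_factors_through_iff[OF d] m A by simp
qed

lemma factors_through_image_mono:
  assumes "dagger_mono C m" "is_epic C e" "Dom C m = Cod C e"
    and "dagger_mono C m'" "is_epic C e'" "Dom C m' = Cod C e'"
    and "Cod C m = Cod C m'" "factors_through C (m \<cdot> e) (m' \<cdot> e')"
  shows "factors_through C m m'"
proof -
  have A: "m \<in> Arr C" "e \<in> Arr C" "m' \<in> Arr C" "e' \<in> Arr C"
    using assms by (auto simp: dagger_mono_def is_epic_def)
  then have "factors_through C (m' \<cdot> e') m'"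
    using assms by (intro factors_throughI[of e']) auto
  then have "factors_through C (m \<cdot> e) m'"
    using factors_through_trans assms A by blast
  then show ?thesis
    using factors_through_image_least[OF assms(4,2)] assms(3,7) A by simp
qed

text \<open>The two factored arrows need not be equal. Equal arrows give uniqueness of
  \<open>Im\<close>; mutually factoring ones give independence of the representative in
  \<open>exists_along\<close>.\<close>

lemma image_subobject_unique:
  assumes "dagger_mono C m" "is_epic C e" "Dom C m = Cod C e"
    and "dagger_mono C m'" "is_epic C e'" "Dom C m' = Cod C e'"
    and "Cod C m = Cod C m'" "factors_through C (m \<cdot> e) (m' \<cdot> e')"
    "factors_through C (m' \<cdot> e') (m \<cdot> e)"
  shows "subobject C m = subobject C m'"
  using factors_through_image_mono[OF assms(1-8)] factors_through_image_mono[OF assms(4-6,1-3) assms(7)[symmetric] assms(9)]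
    assms(1,4,7) by (intro subobject_eqI dagger_mono_imp_monic) auto

section \<open>\<open>Im\<close>, \<open>exists_along\<close> and \<open>perp\<close> on chosen
  representatives\<close>

lemma Im_eq:
  assumes "dagger_mono C m" "is_epic C e" "Dom C m = Cod C e"
  shows "Im C (m \<cdot> e) = subobject C m"
  unfolding Im_def
proof (rule the_equality)
  show "\<exists>m' e'. dagger_mono C m' \<and> is_epic C e' \<and> Dom C m' = Cod C e' \<and> m \<cdot> e = m' \<cdot> e' \<and>
    subobject C m = subobject C m'"
    using assms by blast
next
  fix S
  assume "\<exists>m' e'. dagger_mono C m' \<and> is_epic C e' \<and> Dom C m' = Cod C e' \<and> m \<cdot> e = m' \<cdot> e' \<and>
    S = subobject C m'"
  then obtain m' e' where m': "dagger_mono C m'" "is_epic C e'" "Dom C m' = Cod C e'"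
    "m \<cdot> e = m' \<cdot> e'" "S = subobject C m'"
    by blast
  have "m \<in> Arr C" "e \<in> Arr C" "m' \<in> Arr C" "e' \<in> Arr C"
    using assms m' by (auto simp: dagger_mono_def is_epic_def)
  then have "Cod C m = Cod C m'" "m \<cdot> e \<in> Arr C"
    using assms(3) m'(3,4) by (metis Comp_Arr(3), simp)
  then show "S = subobject C m"
    using image_subobject_unique[OF assms m'(1-3)] m'(4,5) by (simp add: factors_through_refl)
qed

text \<open>If \<open>n\<close> is another dagger-mono representative, then \<open>m\<close> and
  \<open>n\<close> factor through each other, hence so do \<open>f \<cdot> m\<close> and
  \<open>f \<cdot> n\<close>, and their images coincide.\<close>

lemma exists_along_subobject:
  assumes m: "dagger_mono C m" "Cod C m = Dom C f" and f: "f \<in> Arr C"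
  shows "exists_along C f (subobject C m) = Im C (f \<cdot> m)"
  unfolding exists_along_def
proof (rule the_equality)
  show "\<exists>n \<in> subobject C m. dagger_mono C n \<and> Im C (f \<cdot> m) = Im C (f \<cdot> n)"
    using m self_mem_subobject[of m] dagger_mono_imp_monic by blast
next
  fix S
  assume "\<exists>n \<in> subobject C m. dagger_mono C n \<and> S = Im C (f \<cdot> n)"
  then obtain n where n: "dagger_mono C n" "Cod C n = Cod C m" "factors_through C m n"
    "factors_through C n m" "S = Im C (f \<cdot> n)"
    using dagger_mono_imp_monic[OF m(1)] by (auto simp: mem_subobject_iff)
  have A: "m \<in> Arr C" "n \<in> Arr C"
    using m n by (auto simp: dagger_mono_def)
  have "f \<cdot> m \<in> Arr C" "f \<cdot> n \<in> Arr C"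
    using A m n f by auto
  then obtain p e p' e' where p: "dagger_mono C p" "is_epic C e" "Dom C p = Cod C e" "f \<cdot> m = p \<cdot> e"
    and p': "dagger_mono C p'" "is_epic C e'" "Dom C p' = Cod C e'" "f \<cdot> n = p' \<cdot> e'"
    by (metis epi_dagger_mono_factorisation)
  have B: "p \<in> Arr C" "e \<in> Arr C" "p' \<in> Arr C" "e' \<in> Arr C"
    using p p' by (auto simp: dagger_mono_def is_epic_def)
  have "Cod C p = Cod C (f \<cdot> m)" "Cod C p' = Cod C (f \<cdot> n)"
    using p p' B by auto
  then have "Cod C p' = Cod C p"
    using A m n f by simp
  moreover have "factors_through C (p \<cdot> e) (p' \<cdot> e')" "factors_through C (p' \<cdot> e') (p \<cdot> e)"
    using factors_through_Comp_left[OF n(3), of f] factors_through_Comp_left[OF n(4), of f]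
      A m n f p(4) p'(4) by simp_all
  ultimately have "subobject C p' = subobject C p"
    using image_subobject_unique[OF p'(1-3) p(1-3)] by simp
  then show "S = Im C (f \<cdot> m)"
    using n(5) p p' by (simp add: Im_eq)
qed

text \<open>Both the representative and its dagger kernel are choices. Antitonicity of the
  orthocomplement, applied in both directions, removes the two choices at once.\<close>

lemma perp_subobject:
  assumes m: "dagger_mono C m" and k: "dagger_mono C k" "is_kernel C k (Dag C m)"
  shows "perp C (subobject C m) = subobject C k"
  unfolding perp_def
proof (rule the_equality)
  show "\<exists>n \<in> subobject C m. dagger_mono C n \<and>
    (\<exists>l. dagger_mono C l \<and> is_kernel C l (Dag C n) \<and> subobject C k = subobject C l)"
    using assms self_mem_subobject[of m] dagger_mono_imp_monic by blast
next
  \<comment> \<open>If \<open>n = m u\<close>, then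
    \<open>n\<^sup>\<dagger> = u\<^sup>\<dagger> m\<^sup>\<dagger>\<close>, so whatever
    \<open>m\<^sup>\<dagger>\<close> annihilates is annihilated by \<open>n\<^sup>\<dagger>\<close>.
    Thus \<open>k\<close> factors through the kernel \<open>l\<close> of
    \<open>n\<^sup>\<dagger>\<close>.\<close>
  have *: "factors_through C k l" if le: "factors_through C n m" and "m \<in> Arr C" "n \<in> Arr C"
    "Cod C n = Cod C m" "is_kernel C k (Dag C m)" "is_kernel C l (Dag C n)" for k l m n
  proof -
    obtain u where u: "u \<in> Arr C" "Dom C u = Dom C n" "Cod C u = Dom C m" "m \<cdot> u = n"
      using le by (rule factors_throughE)
    have kA: "k \<in> Arr C" "Cod C k = Cod C m" "is_zero_arr C (Dag C m \<cdot> k)"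
      using that by (auto simp: is_kernel_def)
    have "is_zero_arr C (Dag C u \<cdot> (Dag C m \<cdot> k))"
      by (rule is_zero_arr_Comp_left[OF kA(3)]) (use kA that(2) u in auto)
    then have "is_zero_arr C (Dag C n \<cdot> k)"
      using kA that(2) u Dag_Comp_Arr[of u m] by simp
    then show ?thesis
      using is_kernel_factors_through_iff[OF that(6)] kA that by simp
  qed
  fix S
  assume "\<exists>n \<in> subobject C m. dagger_mono C n \<and>
    (\<exists>l. dagger_mono C l \<and> is_kernel C l (Dag C n) \<and> S = subobject C l)"
  then obtain n l where n: "dagger_mono C n" "Cod C n = Cod C m" "factors_through C m n"
    "factors_through C n m" and l: "dagger_mono C l" "is_kernel C l (Dag C n)" "S = subobject C l"
    using dagger_mono_imp_monic[OF m] by (auto simp: mem_subobject_iff)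
  have A: "m \<in> Arr C" "n \<in> Arr C"
    using m n by (auto simp: dagger_mono_def)
  then have "Cod C l = Cod C k"
    using k l n by (simp add: is_kernel_def)
  then have "subobject C l = subobject C k"
    using *[OF n(4)] *[OF n(3)] A n k l by (intro subobject_eqI dagger_mono_imp_monic) auto
  then show "S = subobject C k"
    using l(3) by simp
qed

text \<open>Here \<open>k\<close> is the kernel of \<open>p\<^sup>\<dagger>\<close>, where
  \<open>p\<close> is the image of \<open>f \<cdot> m\<close>. The criterion mentions neither
  \<open>p\<close> nor its epi part, and its dagger has the same shape with \<open>m\<close> and
  \<open>n\<close> exchanged.\<close>

lemma perp_exists_along_subobject:
  assumes m: "dagger_mono C m" "Cod C m = Dom C f" and f: "f \<in> Arr C"
  obtains k where "dagger_mono C k" "Cod C k = Cod C f"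
    "perp C (exists_along C f (subobject C m)) = subobject C k"
    "\<And>n. n \<in> Arr C \<Longrightarrow> Cod C n = Cod C f \<Longrightarrow>
      factors_through C n k \<longleftrightarrow> is_zero_arr C (Dag C n \<cdot> (f \<cdot> m))"
proof -
  have mA: "m \<in> Arr C"
    using m by (simp add: dagger_mono_def)
  then obtain p e where p: "dagger_mono C p" "is_epic C e" "Dom C p = Cod C e" "f \<cdot> m = p \<cdot> e"
    using epi_dagger_mono_factorisation[of "f \<cdot> m"] m f by auto
  have pA: "p \<in> Arr C" "e \<in> Arr C"
    using p by (auto simp: dagger_mono_def is_epic_def)
  have "Cod C p = Cod C (f \<cdot> m)"
    using p pA by simp
  then have pf: "Cod C p = Cod C f"
    using m f mA by simp
  obtain k where k: "dagger_mono C k" "is_kernel C k (Dag C p)"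
    using dagger_kernel_exists[of "Dag C p"] pA by auto
  show thesis
  proof
    show "dagger_mono C k"
      by (fact k)
    show "Cod C k = Cod C f"
      using k pA pf by (simp add: is_kernel_def)
    show "perp C (exists_along C f (subobject C m)) = subobject C k"
      using exists_along_subobject[OF m f] Im_eq[OF p(1-3)] perp_subobject[OF p(1) k] p(4) by simp
    fix n
    assume n: "n \<in> Arr C" "Cod C n = Cod C f"
    have "factors_through C n k \<longleftrightarrow> is_zero_arr C (Dag C p \<cdot> n)"
      using is_kernel_factors_through_iff[OF k(2)] n pA pf by simp
    \<comment> \<open>Taking daggers puts \<open>p\<close> on the right, where it can be composed
      with the epi \<open>e\<close> to restore \<open>p e = f m\<close> without changing whether the
      composite vanishes.\<close>
    also have "\<dots> \<longleftrightarrow> is_zero_arr C (Dag C n \<cdot> p)"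
      using is_zero_arr_Dag_iff[of "Dag C p \<cdot> n"] n pA pf by simp
    also have "\<dots> \<longleftrightarrow> is_zero_arr C (Dag C n \<cdot> (f \<cdot> m))"
      using is_epic_zero_arr_iff[OF p(2), of "Dag C n \<cdot> p"] n p pA pf by simp
    finally show "factors_through C n k \<longleftrightarrow> is_zero_arr C (Dag C n \<cdot> (f \<cdot> m))" .
  qed
qed

section \<open>The adjunction between \<open>arr_perp C f\<close> and
  \<open>arr_perp C (Dag C f)\<close>\<close>

lemma arr_perp_closed:
  assumes "f \<in> Arr C" "M \<in> carrier (ClSub C (Dom C f))"
  shows "arr_perp C f M \<in> carrier (ClSub C (Cod C f))"
  using assms perp_exists_along_subobject[of _ f] unfolding ClSub_carrier_iff arr_perp_def comp_def
  by metis

lemma sub_le_arr_perp_iff: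
  assumes f: "f \<in> Arr C" and m: "dagger_mono C m" "Cod C m = Dom C f"
    and n: "dagger_mono C n" "Cod C n = Cod C f"
  shows "sub_le C (subobject C n) (arr_perp C f (subobject C m)) \<longleftrightarrow>
    is_zero_arr C (Dag C n \<cdot> (f \<cdot> m))"
proof -
  obtain k where k: "dagger_mono C k" "perp C (exists_along C f (subobject C m)) = subobject C k"
    and *: "\<And>n. \<lbrakk>n \<in> Arr C; Cod C n = Cod C f\<rbrakk> \<Longrightarrow>
      factors_through C n k \<longleftrightarrow> is_zero_arr C (Dag C n \<cdot> (f \<cdot> m))"
    using perp_exists_along_subobject[OF m f] by metis
  have "factors_through C n k \<longleftrightarrow> is_zero_arr C (Dag C n \<cdot> (f \<cdot> m))"
    using n by (intro *) (simp_all add: dagger_mono_def)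
  moreover have "arr_perp C f (subobject C m) = subobject C k"
    using k(2) by (simp add: arr_perp_def)
  ultimately show ?thesis
    using n k(1) by (simp add: sub_le_subobject_iff dagger_mono_imp_monic)
qed

lemma arr_perp_adjoint:
  assumes f: "f \<in> Arr C" and M: "M \<in> carrier (ClSub C (Dom C f))"
    and N: "N \<in> carrier (ClSub C (Cod C f))"
  shows "sub_le C N (arr_perp C f M) \<longleftrightarrow> sub_le C M (arr_perp C (Dag C f) N)"
proof -
  obtain m n where m: "dagger_mono C m" "Cod C m = Dom C f" "M = subobject C m"
    and n: "dagger_mono C n" "Cod C n = Cod C f" "N = subobject C n"
    using M N by (auto simp: ClSub_carrier_iff)
  have A: "m \<in> Arr C" "n \<in> Arr C"
    using m n by (auto simp: dagger_mono_def)
  have "sub_le C N (arr_perp C f M) \<longleftrightarrow> is_zero_arr C (Dag C n \<cdot> (f \<cdot> m))"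
    using sub_le_arr_perp_iff[OF f m(1,2) n(1,2)] m n by simp
  also have "\<dots> \<longleftrightarrow> is_zero_arr C (Dag C m \<cdot> (Dag C f \<cdot> n))"
    using is_zero_arr_Dag_iff[of "Dag C n \<cdot> (f \<cdot> m)"] A m n f by simp
  \<comment> \<open>The same vanishing criterion, now for \<open>Dag C f\<close>, whose domain is
    the codomain of \<open>f\<close>; so \<open>n\<close> is the subobject being mapped and
    \<open>m\<close> the one being tested.\<close>
  also have "\<dots> \<longleftrightarrow> sub_le C M (arr_perp C (Dag C f) N)"
    using sub_le_arr_perp_iff[of "Dag C f" n m] m n f by simp
  finally show ?thesis .
qed

end

theorem theorem4:
  fixes H (structure)
  assumes "pre_hilbert_category H" and "f \<in> Hom H X Y"
  shows "galois_connection
      \<lparr>orderA = ClSub H X, orderB = inv_gorder (ClSub H Y),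
       lower = arr_perp H f, upper = arr_perp H (Dag H f)\<rparr> \<and>
    (\<forall>M \<in> carrier (ClSub H X). \<forall>N \<in> carrier (ClSub H Y).
      N \<sqsubseteq>\<^bsub>ClSub H Y\<^esub> perp H (exists_along H f M) \<longleftrightarrow>
      M \<sqsubseteq>\<^bsub>ClSub H X\<^esub> perp H (exists_along H (Dag H f) N))"
proof -
  interpret pre_hilbert_category H
    by fact
  have f: "f \<in> Arr H" "Dom H f = X" "Cod H f = Y"
    using assms(2) by (auto simp: Hom_def)
  have adj: "N \<sqsubseteq>\<^bsub>ClSub H Y\<^esub> arr_perp H f M \<longleftrightarrow> M \<sqsubseteq>\<^bsub>ClSub H X\<^esub> arr_perp H (Dag H f) N"
    if "M \<in> carrier (ClSub H X)" "N \<in> carrier (ClSub H Y)" for M N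
    using arr_perp_adjoint[OF f(1)] that f by (simp add: le_ClSub)
  interpret Y: partial_order "ClSub H Y"
    by (rule partial_order_ClSub)
  \<comment> \<open>The dual order on \<open>ClSub H Y\<close> encodes contravariance: below
    \<open>N\<close> in the dual means above \<open>N\<close> in \<open>ClSub H Y\<close>, which
    turns the Galois condition into \<open>adj\<close>.\<close>
  have "partial_order (inv_gorder (ClSub H Y))"
    using Y.dual_weak_order Y.eq_is_equal
    by (auto simp: partial_order_def partial_order_axioms_def)
  then have "galois_connection
      \<lparr>orderA = ClSub H X, orderB = inv_gorder (ClSub H Y),
       lower = arr_perp H f, upper = arr_perp H (Dag H f)\<rparr>"
    using adj partial_order_ClSub[of X] arr_perp_closed[of f] arr_perp_closed[of "Dag H f"] f
    by (auto simp: galois_connection_def galois_connection_axioms_def connection_def)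
  then show ?thesis
    using adj by (simp add: arr_perp_def)
qed

end
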